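(* Let $\Delta=\sum_{i=1}^h T(L_i,M_i)$ be a convenient Newton diagram written in its canonical form. Put $H_0=1$, $H_i=1+M_1+\dots+M_i$ for $i\in\{1,\dots,h\}$, and $C_0=H_h$, $C_i=H_{i-1}L_i/M_i$ for $i\in\{1,\dots,h\}$. Then $\Delta$ is a Merle type diagram if and only if the following arithmetic conditions are satisfied: (i) the quotients $H_i/H_{i-1}$ are integers for $i\in\{2,\dots,h\}$; (ii) the quotients $C_i$ are integers for $i\in\{1,\dots,h\}$; (iii) $\gcd(C_0,\dots,C_i)=C_0/H_i$ for $i\in\{1,\dots,h\}$. Moreover, in such a case $\Delta=\mathcal{M}(C_0,\dots,C_h)$.
   Context: Write $\mathbf{R}_+=\{x\in\mathbf{R}:x\ge 0\}$. For a non-zero convergent power series $f=\sum a_{i,j}x^iy^j\in\mathbf{C}\{x,y\}$, put $\mathrm{supp}\, f=\{(i,j):a_{i,j}\neq 0\}$; the Newton diagram of $f$ is $\Delta_f=$ the convex hull of $\mathrm{supp}\, f+\mathbf{R}_+^2$. Newton diagrams are added by Minkowski sum. Elementary Newton diagrams: for positive integers $L,M$ put $T(L,M)=\Delta_{x^L+y^M}$; also $T(L,\infty)=\Delta_{x^L}$ and $T(\infty,M)=\Delta_{y^M}$. The inclination of $T(L,M)$ is $L/M$, with $L/\infty=0$ and $\infty/M=+\infty$. Every Newton diagram $\Delta\subsetneq\mathbf{R}_+^2$ has a unique representation $\Delta=\sum_{i=1}^r T(L_i,M_i)$ in which the inclinations of successive elementary diagrams form a (strictly) increasing sequence; this is its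 canonical form. A Newton diagram is convenient if it intersects both coordinate axes (so all $L_i,M_i$ in its canonical form are finite positive integers). Merle type diagrams: let $\bar b_0,\bar b_1,\dots,\bar b_h$ ($h\ge 1$) be a sequence of positive integers and set $n_k=\gcd(\bar b_0,\dots,\bar b_{k-1})/\gcd(\bar b_0,\dots,\bar b_k)$ for $k\in\{1,\dots,h\}$. Suppose that (Z$_1$) $n_k>1$ for $k\in\{1,\dots,h\}$ and $n_1\cdots n_h=\bar b_0$; (Z$_2$) $n_k\bar b_k<\bar b_{k+1}$ for $k\in\{1,\dots,h-1\}$. Then put $$\mathcal{M}(\bar b_0,\dots,\bar b_h)=\sum_{k=1}^h T\big((n_k-1)\bar b_k,\ (n_k-1)n_1\cdots n_{k-1}\big).$$ A Newton diagram is called a Merle type diagram if it equals $\mathcal{M}(\bar b_0,\dots,\bar b_h)$ for some sequence satisfying (Z$_1$) and (Z$_2$). *)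

theory Defs
  imports "HOL-Analysis.Analysis" "HOL-Computational_Algebra.Formal_Power_Series"
begin

(* Bivariate power series over the complex numbers are elements of C[[y]][[x]]:
   the coefficient of x^i y^j is the j-th coefficient of the i-th coefficient. *)
type_synonym bifps = "complex fps fps"

definition bi_coeff :: "bifps \<Rightarrow> nat \<Rightarrow> nat \<Rightarrow> complex" where
  "bi_coeff f i j = fps_nth (fps_nth f i) j"

definition bi_X :: bifps where
  "bi_X = fps_X"

definition bi_Y :: bifps where
  "bi_Y = fps_const fps_X"

(* Membership in C{x,y}: the double series converges (unconditionally)
   on a polydisc around the origin. *)
definition bi_convergent :: "bifps \<Rightarrow> bool" where
  "bi_convergent f \<longleftrightarrow> (\<exists>r>0. \<forall>x y. cmod x < r \<longrightarrow> cmod y < r \<longrightarrow>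
     (\<lambda>(i, j). bi_coeff f i j * x ^ i * y ^ j) summable_on UNIV)"

definition bi_supp :: "bifps \<Rightarrow> (nat \<times> nat) set" where
  "bi_supp f = {(i, j). bi_coeff f i j \<noteq> 0}"

definition quadrant :: "(real \<times> real) set" where
  "quadrant = {(x, y). 0 \<le> x \<and> 0 \<le> y}"

(* Here and below, + and sums of sets are Minkowski sums (HOL-Library.Set_Algebras). *)
definition newton :: "bifps \<Rightarrow> (real \<times> real) set" where
  "newton f = convex hull ((\<lambda>(i, j). (real i, real j)) ` bi_supp f + quadrant)"

definition newton_diagram :: "(real \<times> real) set \<Rightarrow> bool" where
  "newton_diagram D \<longleftrightarrow> (\<exists>f. f \<noteq> 0 \<and> bi_convergent f \<and> D = newton f)"

definition convenient :: "(real \<times> real) set \<Rightarrow> bool" where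
  "convenient D \<longleftrightarrow> (\<exists>x. (x, 0) \<in> D) \<and> (\<exists>y. (0, y) \<in> D)"

(* The value at two infinite arguments is irrelevant: canonical forms exclude it. *)
fun T :: "enat \<Rightarrow> enat \<Rightarrow> (real \<times> real) set" where
  "T (enat l) (enat m) = newton (bi_X ^ l + bi_Y ^ m)"
| "T (enat l) \<infinity> = newton (bi_X ^ l)"
| "T \<infinity> (enat m) = newton (bi_Y ^ m)"
| "T \<infinity> \<infinity> = {}"

(* Division of extended reals gives l / \<infinity> = 0 and \<infinity> / m = \<infinity> for finite l, m > 0. *)
definition inclination :: "enat \<Rightarrow> enat \<Rightarrow> ereal" where
  "inclination l m = ereal_of_enat l / ereal_of_enat m"

definition canonical_form :: "(real \<times> real) set \<Rightarrow> nat \<Rightarrow> (nat \<Rightarrow> enat) \<Rightarrow> (nat \<Rightarrow> enat) \<Rightarrow> bool" where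
  "canonical_form D r L M \<longleftrightarrow> 1 \<le> r
     \<and> (\<forall>i\<in>{1..r}. 0 < L i \<and> 0 < M i \<and> \<not> (L i = \<infinity> \<and> M i = \<infinity>))
     \<and> (\<forall>i\<in>{1..<r}. inclination (L i) (M i) < inclination (L (i + 1)) (M (i + 1)))
     \<and> D = (\<Sum>i=1..r. T (L i) (M i))"

(* For positive b the division is exact, since the gcds form a divisor chain. *)
definition merle_n :: "(nat \<Rightarrow> nat) \<Rightarrow> nat \<Rightarrow> nat" where
  "merle_n b k = Gcd (b ` {0..<k}) div Gcd (b ` {0..k})"

definition merle_seq :: "nat \<Rightarrow> (nat \<Rightarrow> nat) \<Rightarrow> bool" where
  "merle_seq h b \<longleftrightarrow> 1 \<le> h \<and> (\<forall>k\<in>{0..h}. 0 < b k)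
     \<and> (\<forall>k\<in>{1..h}. 1 < merle_n b k) \<and> (\<Prod>k=1..h. merle_n b k) = b 0
     \<and> (\<forall>k\<in>{1..<h}. merle_n b k * b k < b (k + 1))"

definition merle_diagram :: "nat \<Rightarrow> (nat \<Rightarrow> nat) \<Rightarrow> (real \<times> real) set" where
  "merle_diagram h b = (\<Sum>k=1..h. T (enat ((merle_n b k - 1) * b k))
     (enat ((merle_n b k - 1) * (\<Prod>j=1..<k. merle_n b j))))"

definition merle_type :: "(real \<times> real) set \<Rightarrow> bool" where
  "merle_type D \<longleftrightarrow> (\<exists>h b. merle_seq h b \<and> D = merle_diagram h b)"

definition H_seq :: "(nat \<Rightarrow> nat) \<Rightarrow> nat \<Rightarrow> nat" where
  "H_seq M i = 1 + (\<Sum>k=1..i. M k)"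

definition C_seq :: "nat \<Rightarrow> (nat \<Rightarrow> nat) \<Rightarrow> (nat \<Rightarrow> nat) \<Rightarrow> nat \<Rightarrow> rat" where
  "C_seq h L M i = (if i = 0 then of_nat (H_seq M h)
     else of_nat (H_seq M (i - 1)) * of_nat (L i) / of_nat (M i))"

(* The same sequence as natural numbers, needed to form gcds and Merle diagrams.
   It agrees with C_seq wherever the (non-negative) rational C_seq h L M i is an integer. *)
definition C_nat :: "nat \<Rightarrow> (nat \<Rightarrow> nat) \<Rightarrow> (nat \<Rightarrow> nat) \<Rightarrow> nat \<Rightarrow> nat" where
  "C_nat h L M i = nat \<lfloor>C_seq h L M i\<rfloor>"

(* The integrality conjunct makes C_nat in the gcd conjunct coincide with C_seq. *)
definition arith_conditions :: "nat \<Rightarrow> (nat \<Rightarrow> nat) \<Rightarrow> (nat \<Rightarrow> nat) \<Rightarrow> bool" where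
  "arith_conditions h L M \<longleftrightarrow>
     (\<forall>i\<in>{2..h}. (of_nat (H_seq M i) / of_nat (H_seq M (i - 1)) :: rat) \<in> \<int>)
     \<and> (\<forall>i\<in>{1..h}. C_seq h L M i \<in> \<int>)
     \<and> (\<forall>i\<in>{1..h}. of_nat (Gcd (C_nat h L M ` {0..i})) = C_seq h L M 0 / of_nat (H_seq M i))"

end

theory Submission
  imports Defs
begin

text \<open>
  The canonical form can be read off the support function
  \<open>t \<mapsto> min {x + t y | (x, y) \<in> \<Delta>}\<close>, \<open>t > 0\<close>. This function is additive in \<open>\<Delta>\<close> and
  equals \<open>min L (t M)\<close> for \<open>T(L, M)\<close>, so its breakpoints are the inclinations and the
  change of slope at the breakpoint \<open>L\<^sub>i / M\<^sub>i\<close> is \<open>M\<^sub>i\<close>. Condition (Z2) says that the sum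
  defining a Merle type diagram is already in canonical form. Hence \<open>\<Delta>\<close> is of Merle type
  iff \<open>L\<^sub>k = (n\<^sub>k - 1) b\<^sub>k\<close> and \<open>M\<^sub>k = (n\<^sub>k - 1) n\<^sub>1 \<cdots> n\<^sub>k\<^sub>-\<^sub>1\<close>; the latter telescopes to
  \<open>H\<^sub>k = n\<^sub>1 \<cdots> n\<^sub>k\<close>, and then \<open>C\<^sub>k = b\<^sub>k\<close>.
\<close>

section \<open>Minima of linear forms on Newton diagrams\<close>

text \<open>The value \<open>v\<close> at \<open>t\<close> of the support function of
  \<open>D\<close> in direction \<open>(1, t)\<close>. A relation, not an infimum: attainment is
  part of it, so uniqueness and additivity need no boundedness argument.\<close>

definition min_on :: "real \<Rightarrow> (real \<times> real) set \<Rightarrow> real \<Rightarrow> bool" where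
  "min_on t D v \<longleftrightarrow> (\<exists>p\<in>D. fst p + t * snd p = v) \<and> (\<forall>p\<in>D. v \<le> fst p + t * snd p)"

lemma min_on_unique: "min_on t D v \<Longrightarrow> min_on t D w \<Longrightarrow> v = w"
  unfolding min_on_def by (metis order_antisym)

lemma min_on_plus:
  assumes "min_on t A v" "min_on t B w"
  shows "min_on t (A + B) (v + w)"
proof -
  obtain p q where "p \<in> A" "q \<in> B" "fst p + t * snd p = v" "fst q + t * snd q = w"
    using assms unfolding min_on_def by blast
  then have "p + q \<in> A + B" "fst (p + q) + t * snd (p + q) = v + w"
    by (auto simp: set_plus_intro algebra_simps)
  moreover have "v + w \<le> fst p + t * snd p" if "p \<in> A + B" for p
  proof -
    obtain a b where ab: "p = a + b" "a \<in> A" "b \<in> B"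
      using \<open>p \<in> A + B\<close> by (rule set_plus_elim)
    then have "v \<le> fst a + t * snd a" "w \<le> fst b + t * snd b"
      using assms unfolding min_on_def by auto
    then show ?thesis using ab by (simp add: algebra_simps)
  qed
  ultimately show ?thesis unfolding min_on_def by blast
qed

lemma min_on_sum:
  assumes "finite I" "\<And>i. i \<in> I \<Longrightarrow> min_on t (A i) (v i)"
  shows "min_on t (\<Sum>i\<in>I. A i) (\<Sum>i\<in>I. v i)"
  using assms
proof (induction I rule: finite_induct)
  case empty
  then show ?case by (simp add: min_on_def)
next
  case (insert i I)
  then show ?case by (simp add: min_on_plus)
qed

lemma bi_supp_X_plus_Y:
  assumes "0 < l" "0 < m"
  shows "bi_supp (bi_X ^ l + bi_Y ^ m) = {(l, 0), (0, m)}"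
proof -
  have "bi_coeff (bi_X ^ l + bi_Y ^ m) i j =
      (if i = l \<and> j = 0 then 1 else 0) + (if i = 0 \<and> j = m then 1 else 0)" for i j
    by (auto simp: bi_coeff_def bi_X_def bi_Y_def fps_const_power fps_X_power_nth)
  then show ?thesis using assms by (auto simp: bi_supp_def)
qed

text \<open>For \<open>t > 0\<close> the form decreases nowhere along \<open>quadrant\<close>, and a
  half-space is convex, so the bound at the two vertices passes to the convex hull; one of the
  vertices attains it.\<close>

lemma min_on_T:
  assumes "0 < l" "0 < m" "0 < t"
  shows "min_on t (T (enat l) (enat m)) (min (real l) (t * real m))"
proof -
  let ?S = "{(real l, 0), (0, real m)}"
  let ?v = "min (real l) (t * real m)"
  have T: "T (enat l) (enat m) = convex hull (?S + quadrant)"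
    using assms by (simp add: newton_def bi_supp_X_plus_Y)
  have "?S + quadrant \<subseteq> {p. (1, t) \<bullet> p \<ge> ?v}"
  proof
    fix p assume "p \<in> ?S + quadrant"
    then obtain a x y where p: "p = a + (x, y)" "a \<in> ?S" "0 \<le> x" "0 \<le> y"
      unfolding quadrant_def by (elim set_plus_elim) auto
    moreover have "0 \<le> t * y" using p assms by simp
    ultimately show "p \<in> {p. (1, t) \<bullet> p \<ge> ?v}"
      by (auto simp: inner_prod_def algebra_simps)
  qed
  then have lower: "convex hull (?S + quadrant) \<subseteq> {p. (1, t) \<bullet> p \<ge> ?v}"
    by (rule hull_minimal) (rule convex_halfspace_ge)
  \<comment> \<open>Adding the origin shows that the vertices themselves lie in the diagram.\<close>
  have "(0, 0) \<in> quadrant" by (simp add: quadrant_def)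
  then have "a \<in> T (enat l) (enat m)" if "a \<in> ?S" for a
    using hull_inc[of "a + (0, 0)" "?S + quadrant" convex] that
    unfolding T by (metis add.right_neutral set_plus_intro zero_prod_def)
  then have "(real l, 0) \<in> T (enat l) (enat m)" "(0, real m) \<in> T (enat l) (enat m)"
    by blast+
  then have "\<exists>p\<in>T (enat l) (enat m). fst p + t * snd p = ?v"
    by (cases "real l \<le> t * real m") (force simp: min_def)+
  with lower show ?thesis unfolding min_on_def T by (auto simp: inner_prod_def)
qed

section \<open>Uniqueness of finite canonical forms\<close>

text \<open>The map sending \<open>u\<close> to \<open>min l (u * m)\<close> is piecewise linear
  with slope \<open>m\<close> before \<open>l / m\<close> and slope 0 after. The second difference
  divided by \<open>e\<close>, not by its square, tends to the left slope minus the right slope at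
  \<open>t\<close>. It is even constant for small \<open>e\<close>.\<close>

lemma kink_min:
  assumes "0 < (m::real)"
  shows "((\<lambda>e. (2 * min l (t * m) - min l ((t - e) * m) - min l ((t + e) * m)) / e)
    \<longlongrightarrow> (if l / m = t then m else 0)) (at_right 0)"
proof (rule tendsto_eventually)
  consider "l = t * m" | "l < t * m" | "t * m < l" by linarith
  then have "\<exists>d>0. \<forall>e. 0 < e \<longrightarrow> e < d \<longrightarrow>
    (2 * min l (t * m) - min l ((t - e) * m) - min l ((t + e) * m)) / e
      = (if l / m = t then m else 0)"
  proof cases
    case 1
    have "min l ((t - e) * m) = l - e * m" "min l ((t + e) * m) = l" if "0 < e" for e
      using 1 mult_pos_pos[OF that assms] by (auto simp: min_def algebra_simps)
    then show ?thesis using 1 assms by (intro exI[of _ 1]) auto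
  next
    case 2
    have "min l ((t - e) * m) = l" "min l ((t + e) * m) = l"
      if "0 < e" "e * m < t * m - l" for e
      using 2 that mult_pos_pos[OF that(1) assms] by (auto simp: min_def algebra_simps)
    \<comment> \<open>For smaller \<open>e\<close> the point \<open>t - e\<close> stays to the right
      of the breakpoint; in the next case the analogous bound keeps \<open>t + e\<close> to its
      left.\<close>
    then show ?thesis using 2 assms by (intro exI[of _ "(t * m - l) / m"])
      (auto simp: pos_less_divide_eq)
  next
    case 3
    have "min l ((t - e) * m) = t * m - e * m" "min l ((t + e) * m) = t * m + e * m"
      if "0 < e" "e * m < l - t * m" for e
      using 3 that mult_pos_pos[OF that(1) assms] by (auto simp: min_def algebra_simps)
    then show ?thesis using 3 assms by (intro exI[of _ "(l - t * m) / m"])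
      (auto simp: pos_less_divide_eq)
  qed
  then show "\<forall>\<^sub>F e in at_right 0.
    (2 * min l (t * m) - min l ((t - e) * m) - min l ((t + e) * m)) / e
      = (if l / m = t then m else 0)"
    unfolding eventually_at_right_field by auto
qed

lemma inclination_less_iff:
  assumes "0 < m" "0 < m'"
  shows "inclination (enat l) (enat m) < inclination (enat l') (enat m')
    \<longleftrightarrow> real l / real m < real l' / real m'"
  using assms by (simp add: inclination_def)

lemma canonical_form_finiteD:
  assumes "canonical_form D r (\<lambda>i. enat (L i)) (\<lambda>i. enat (M i))"
  shows "1 \<le> r" "i \<in> {1..r} \<Longrightarrow> 0 < L i" "i \<in> {1..r} \<Longrightarrow> 0 < M i"
    "D = (\<Sum>i=1..r. T (enat (L i)) (enat (M i)))"
    "i \<in> {1..<r} \<Longrightarrow> real (L i) / real (M i) < real (L (i + 1)) / real (M (i + 1))"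
proof -
  show pos: "1 \<le> r" "i \<in> {1..r} \<Longrightarrow> 0 < L i" "i \<in> {1..r} \<Longrightarrow> 0 < M i"
    "D = (\<Sum>i=1..r. T (enat (L i)) (enat (M i)))" for i
    using assms by (auto simp: canonical_form_def zero_enat_def)
  show "real (L i) / real (M i) < real (L (i + 1)) / real (M (i + 1))" if "i \<in> {1..<r}"
  proof -
    have "inclination (enat (L i)) (enat (M i)) < inclination (enat (L (i + 1))) (enat (M (i + 1)))"
      using assms that unfolding canonical_form_def by blast
    then show ?thesis
      using inclination_less_iff pos(3)[of i] pos(3)[of "i + 1"] that by simp
  qed
qed

lemma canonical_form_inclination_strict_mono:
  assumes "canonical_form D r (\<lambda>i. enat (L i)) (\<lambda>i. enat (M i))"
  shows "strict_mono_on {1..r} (\<lambda>i. real (L i) / real (M i))"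
proof (rule strict_mono_onI)
  fix i j assume "i \<in> {1..r}" "j \<in> {1..r}" "i < j"
  then have "1 \<le> i" "j \<le> r" by auto
  show "real (L i) / real (M i) < real (L j) / real (M j)"
    using \<open>i < j\<close> \<open>j \<le> r\<close>
  proof (induction j)
    case (Suc j)
    then have "real (L j) / real (M j) < real (L (j + 1)) / real (M (j + 1))"
      using \<open>1 \<le> i\<close> canonical_form_finiteD(5)[OF assms, of j] by simp
    then show ?case using Suc by (cases "i = j") auto
  qed simp
qed

text \<open>Either side is the drop of slope at \<open>t\<close> of the support function, which is
  determined by \<open>D\<close> alone.\<close>

lemma canonical_form_kinks_eq:
  assumes "canonical_form D r (\<lambda>i. enat (L i)) (\<lambda>i. enat (M i))"
    and "canonical_form D s (\<lambda>i. enat (L' i)) (\<lambda>i. enat (M' i))" and "0 < t"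
  shows "(\<Sum>i=1..r. if real (L i) / real (M i) = t then real (M i) else 0)
    = (\<Sum>i=1..s. if real (L' i) / real (M' i) = t then real (M' i) else 0)"
proof -
  define \<phi> where "\<phi> r L M u = (\<Sum>i=1..r. min (real (L i)) (u * real (M i)))"
    for r and L M :: "nat \<Rightarrow> nat" and u
  have min: "min_on u D (\<phi> r L M u)"
    if "canonical_form D r (\<lambda>i. enat (L i)) (\<lambda>i. enat (M i))" "0 < u" for r L M u
    unfolding \<phi>_def canonical_form_finiteD(4)[OF that(1)]
    using that canonical_form_finiteD(2,3)[OF that(1)] by (intro min_on_sum min_on_T) auto
  have eq: "\<phi> r L M u = \<phi> s L' M' u" if "0 < u" for u
    using min_on_unique min[OF assms(1) that] min[OF assms(2) that] by blast
  have lim: "((\<lambda>e. (2 * \<phi> r L M t - \<phi> r L M (t - e) - \<phi> r L M (t + e)) / e) \<longlongrightarrow>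
      (\<Sum>i=1..r. if real (L i) / real (M i) = t then real (M i) else 0)) (at_right 0)"
    if "canonical_form D r (\<lambda>i. enat (L i)) (\<lambda>i. enat (M i))" for r L M
    unfolding \<phi>_def sum_distrib_left sum_subtractf[symmetric] sum_divide_distrib
    using canonical_form_finiteD(3)[OF that] by (intro tendsto_sum kink_min) simp
  have "\<forall>\<^sub>F e in at_right 0.
      (2 * \<phi> s L' M' t - \<phi> s L' M' (t - e) - \<phi> s L' M' (t + e)) / e
    = (2 * \<phi> r L M t - \<phi> r L M (t - e) - \<phi> r L M (t + e)) / e"
    \<comment> \<open>For \<open>e < t\<close> the arguments \<open>t - e\<close>, \<open>t\<close>
      and \<open>t + e\<close> are all positive, as \<open>eq\<close> demands.\<close>
    unfolding eventually_at_right_field using \<open>0 < t\<close> by (intro exI[of _ t]) (simp add: eq)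
  with lim[OF assms(2)]
  have "((\<lambda>e. (2 * \<phi> r L M t - \<phi> r L M (t - e) - \<phi> r L M (t + e)) / e) \<longlongrightarrow>
      (\<Sum>i=1..s. if real (L' i) / real (M' i) = t then real (M' i) else 0)) (at_right 0)"
    by (rule Lim_transform_eventually)
  with lim[OF assms(1)] show ?thesis
    by (rule tendsto_unique[OF trivial_limit_at_right_real])
qed

text \<open>Inclinations in a canonical form are pairwise distinct, so a single summand
  survives.\<close>

lemma canonical_form_kink:
  assumes "canonical_form D r (\<lambda>i. enat (L i)) (\<lambda>i. enat (M i))" "i \<in> {1..r}"
  shows "(\<Sum>j=1..r. if real (L j) / real (M j) = real (L i) / real (M i) then real (M j) else 0)
    = real (M i)"
proof -
  have "inj_on (\<lambda>i. real (L i) / real (M i)) {1..r}"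
    by (rule strict_mono_on_imp_inj_on[OF canonical_form_inclination_strict_mono[OF assms(1)]])
  then have "(\<Sum>j=1..r. if real (L j) / real (M j) = real (L i) / real (M i) then real (M j) else 0)
    = (\<Sum>j=1..r. if j = i then real (M j) else 0)"
    using assms(2) by (intro sum.cong refl) (auto dest: inj_onD)
  with assms(2) show ?thesis by simp
qed

text \<open>The drop of slope at \<open>L i / M i\<close> is \<open>M i > 0\<close>, so the other
  form must also have a summand of that inclination.\<close>

lemma canonical_form_inclinations_subset:
  assumes "canonical_form D r (\<lambda>i. enat (L i)) (\<lambda>i. enat (M i))"
    and "canonical_form D s (\<lambda>i. enat (L' i)) (\<lambda>i. enat (M' i))"
  shows "(\<lambda>i. real (L i) / real (M i)) ` {1..r} \<subseteq> (\<lambda>i. real (L' i) / real (M' i)) ` {1..s}"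
proof (rule image_subsetI)
  fix i assume i: "i \<in> {1..r}"
  have pos: "0 < L i" "0 < M i" using canonical_form_finiteD(2,3)[OF assms(1) i] .
  then have "(\<Sum>j=1..s. if real (L' j) / real (M' j) = real (L i) / real (M i)
      then real (M' j) else 0) \<noteq> 0"
    using canonical_form_kinks_eq[OF assms, of "real (L i) / real (M i)"]
      canonical_form_kink[OF assms(1) i] by simp
  then obtain j where "j \<in> {1..s}"
    "(if real (L' j) / real (M' j) = real (L i) / real (M i) then real (M' j) else 0) \<noteq> 0"
    by (rule sum.not_neutral_contains_not_neutral)
  then show "real (L i) / real (M i) \<in> (\<lambda>i. real (L' i) / real (M' i)) ` {1..s}"
    by (intro rev_image_eqI[of j]) (auto split: if_splits)
qed

text \<open>Both functions list the same finite set in increasing order, and a strictly sorted list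
  is determined by its set of elements.\<close>

lemma strict_mono_on_image_unique:
  fixes f g :: "nat \<Rightarrow> 'a::linorder"
  assumes "strict_mono_on {1..r} f" "strict_mono_on {1..s} g" "f ` {1..r} = g ` {1..s}"
  shows "r = s" "i \<in> {1..r} \<Longrightarrow> f i = g i"
proof -
  have sorted: "sorted_wrt (<) (map f [1..<Suc r])" if "strict_mono_on {1..r} f"
    for f :: "nat \<Rightarrow> 'a" and r
    unfolding sorted_wrt_map
    by (rule sorted_wrt_mono_rel[OF _ sorted_wrt_upt], rule strict_mono_onD[OF that])
      (auto simp del: upt_Suc)
  have eq: "map f [1..<Suc r] = map g [1..<Suc s]"
    using assms by (intro strict_sorted_equal sorted)
      (simp_all add: atLeastLessThanSuc_atLeastAtMost del: upt_Suc)
  then have "length (map f [1..<Suc r]) = length (map g [1..<Suc s])" by (rule arg_cong)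
  then show "r = s" by (simp del: upt_Suc)
  show "f i = g i" if "i \<in> {1..r}"
    \<comment> \<open>The lists start at index 1, hence the shift to position
      \<open>i - 1\<close>.\<close>
    using arg_cong[OF eq, of "\<lambda>xs. xs ! (i - 1)"] that \<open>r = s\<close>
    by (cases i) (auto simp del: upt_Suc)
qed

text \<open>The set of inclinations is determined by \<open>D\<close>, hence so is their
  enumeration; the drop of slope then gives \<open>M i\<close>, and the inclination gives
  \<open>L i\<close>.\<close>

lemma canonical_form_unique:
  assumes "canonical_form D r (\<lambda>i. enat (L i)) (\<lambda>i. enat (M i))"
    and "canonical_form D s (\<lambda>i. enat (L' i)) (\<lambda>i. enat (M' i))"
  shows "r = s" "i \<in> {1..r} \<Longrightarrow> L i = L' i" "i \<in> {1..r} \<Longrightarrow> M i = M' i"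
proof -
  have image: "(\<lambda>i. real (L i) / real (M i)) ` {1..r} = (\<lambda>i. real (L' i) / real (M' i)) ` {1..s}"
    using canonical_form_inclinations_subset assms by blast
  note unique = strict_mono_on_image_unique[OF
      canonical_form_inclination_strict_mono[OF assms(1)]
      canonical_form_inclination_strict_mono[OF assms(2)] image]
  show "r = s" by (rule unique(1))
  show M: "M i = M' i" if "i \<in> {1..r}" for i
  proof -
    have i': "i \<in> {1..s}" using that unique(1) by simp
    have "0 < real (L i) / real (M i)"
      using canonical_form_finiteD(2,3)[OF assms(1) that] by simp
    then have "real (M i) = real (M' i)"
      using canonical_form_kinks_eq[OF assms, of "real (L i) / real (M i)"]
        canonical_form_kink[OF assms(1) that] canonical_form_kink[OF assms(2) i'] unique(2)[OF that]
      by simp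
    then show ?thesis by simp
  qed
  show "L i = L' i" if "i \<in> {1..r}"
    using unique(2)[OF that] M[OF that] canonical_form_finiteD(3)[OF assms(1) that] by simp
qed

section \<open>Gcd chains and Merle sequences\<close>

text \<open>Enlarging the set replaces its gcd by a divisor, so the \<open>div\<close> in
  \<open>merle_n\<close> is exact.\<close>

lemma merle_n_mult_Gcd:
  "merle_n b (Suc k) * Gcd (b ` {0..Suc k}) = Gcd (b ` {0..k})"
proof -
  have "Gcd (b ` {0..Suc k}) dvd Gcd (b ` {0..k})"
    by (rule Gcd_greatest, rule Gcd_dvd) auto
  then show ?thesis by (simp add: merle_n_def atLeastLessThanSuc_atLeastAtMost)
qed

text \<open>The quotients of successive gcds telescope, starting from the gcd of \<open>b 0\<close>
  alone. This is the source of arithmetic condition (iii).\<close>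

lemma prod_merle_n_mult_Gcd:
  "(\<Prod>j=1..k. merle_n b j) * Gcd (b ` {0..k}) = b 0"
proof (induction k)
  case (Suc k)
  then show ?case using merle_n_mult_Gcd[of b k] by (simp add: mult.assoc)
qed simp

text \<open>Each \<open>M k\<close> is the difference of two consecutive partial products of
  \<open>n\<close>; the 1 in \<open>H_seq\<close> is the empty product.\<close>

lemma H_seq_telescope:
  assumes "\<And>k. k \<in> {1..h} \<Longrightarrow> 0 < n k"
    and "\<And>k. k \<in> {1..h} \<Longrightarrow> M k = (n k - 1) * (\<Prod>j=1..<k. n j)" and "i \<le> h"
  shows "H_seq M i = (\<Prod>j=1..i. n j)"
  using \<open>i \<le> h\<close>
proof (induction i)
  case (Suc i)
  have "0 < n (Suc i)" using assms(1) Suc.prems by simp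
  \<comment> \<open>Writing the factor as a successor removes the truncated subtraction.\<close>
  then obtain q where "n (Suc i) = Suc q" using gr0_implies_Suc by blast
  moreover have "M (Suc i) = (n (Suc i) - 1) * (\<Prod>j=1..i. n j)"
    using assms(2)[of "Suc i"] Suc.prems by (simp add: atLeastLessThanSuc_atLeastAtMost)
  ultimately show ?case using Suc by (simp add: H_seq_def algebra_simps)
qed (simp add: H_seq_def)

text \<open>The common factor \<open>merle_n b k - 1\<close> cancels in each inclination, leaving
  \<open>b k\<close> over the product of the earlier \<open>merle_n b j\<close>. Comparing
  neighbours and clearing denominators turns the required increase into (Z2).\<close>

lemma canonical_form_merle_diagram:
  assumes "merle_seq h b"
  shows "canonical_form (merle_diagram h b) h (\<lambda>k. enat ((merle_n b k - 1) * b k))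
    (\<lambda>k. enat ((merle_n b k - 1) * (\<Prod>j=1..<k. merle_n b j)))"
proof -
  have b: "0 < b k" if "k \<le> h" for k using assms that by (simp add: merle_seq_def)
  have n: "1 < merle_n b k" if "k \<in> {1..h}" for k using assms that by (simp add: merle_seq_def)
  have P: "0 < (\<Prod>j=1..<k. merle_n b j)" if "k \<le> h" for k
    using n that by (intro prod_pos) (force intro: less_trans[OF zero_less_one])
  have incl: "real ((merle_n b k - 1) * b k) / real ((merle_n b k - 1) * (\<Prod>j=1..<k. merle_n b j))
    = real (b k) / real (\<Prod>j=1..<k. merle_n b j)" if "k \<in> {1..h}" for k
    using n[OF that] by (simp add: mult_divide_mult_cancel_left)
  have "inclination (enat ((merle_n b k - 1) * b k))
          (enat ((merle_n b k - 1) * (\<Prod>j=1..<k. merle_n b j)))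
      < inclination (enat ((merle_n b (k + 1) - 1) * b (k + 1)))
          (enat ((merle_n b (k + 1) - 1) * (\<Prod>j=1..<k + 1. merle_n b j)))"
    if k: "k \<in> {1..<h}" for k
  proof -
    have k': "k \<in> {1..h}" "k + 1 \<in> {1..h}" using k by auto
    have prod: "(\<Prod>j=1..<k + 1. merle_n b j) = merle_n b k * (\<Prod>j=1..<k. merle_n b j)"
      using k by (simp add: mult.commute)
    have "merle_n b k * b k < b (k + 1)" using assms k by (simp add: merle_seq_def)
    then have "real (merle_n b k * b k) < real (b (k + 1))" by (rule less_imp_of_nat_less)
    then have "real (b k) / real (\<Prod>j=1..<k. merle_n b j)
        < real (b (k + 1)) / real (\<Prod>j=1..<k + 1. merle_n b j)"
      unfolding prod using P[of k] n[OF k'(1)] k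
      by (simp add: field_simps del: of_nat_prod)
    then show ?thesis
      using incl[OF k'(1)] incl[OF k'(2)] P[of k] P[of "k + 1"] n[OF k'(1)] n[OF k'(2)] k'
      by (subst inclination_less_iff) (simp_all del: of_nat_mult of_nat_prod)
  qed
  moreover have "0 < (merle_n b k - 1) * b k"
    "0 < (merle_n b k - 1) * (\<Prod>j=1..<k. merle_n b j)" if "k \<in> {1..h}" for k
    using n[OF that] b[of k] P[of k] that by simp_all
  moreover have "1 \<le> h" using assms by (simp add: merle_seq_def)
  ultimately show ?thesis
    unfolding canonical_form_def merle_diagram_def zero_enat_def by (simp del: One_nat_def)
qed

text \<open>In \<open>H_seq M (i - 1) * L i / M i\<close> both the partial product and
  \<open>merle_n b i - 1\<close> cancel, leaving \<open>b i\<close>. For \<open>i = 0\<close>,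
  telescoping and (Z1) give \<open>b 0\<close>.\<close>

lemma C_nat_merle:
  assumes "merle_seq h b"
    and "\<And>k. k \<in> {1..h} \<Longrightarrow> L k = (merle_n b k - 1) * b k"
    and "\<And>k. k \<in> {1..h} \<Longrightarrow> M k = (merle_n b k - 1) * (\<Prod>j=1..<k. merle_n b j)"
    and "i \<le> h"
  shows "C_seq h L M i = of_nat (b i)" "C_nat h L M i = b i"
proof -
  have n: "1 < merle_n b k" if "k \<in> {1..h}" for k using assms(1) that by (simp add: merle_seq_def)
  have n0: "0 < merle_n b k" if "k \<in> {1..h}" for k using n[OF that] by simp
  have H: "H_seq M i = (\<Prod>j=1..i. merle_n b j)" if "i \<le> h" for i
    by (rule H_seq_telescope[OF n0 assms(3) that])
  show C: "C_seq h L M i = of_nat (b i)"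
  proof (cases "i = 0")
    case True
    then show ?thesis using assms(1) H[of h] by (simp add: C_seq_def merle_seq_def)
  next
    case False
    then have i: "i \<in> {1..h}" using \<open>i \<le> h\<close> by simp
    have "{1..<i} = {1..i - 1}" using False by auto
    then have M: "M i = (merle_n b i - 1) * H_seq M (i - 1)"
      using assms(3)[OF i] H[of "i - 1"] \<open>i \<le> h\<close> by simp
    have "H_seq M (i - 1) \<noteq> 0" by (simp add: H_seq_def)
    moreover have "(of_nat (merle_n b i - 1) :: rat) \<noteq> 0" using n[OF i] by simp
    ultimately show ?thesis
      using False by (simp add: C_seq_def assms(2)[OF i] M del: of_nat_diff)
  qed
  then show "C_nat h L M i = b i" by (simp add: C_nat_def)
qed

section \<open>The two implications between Merle type and the arithmetic conditions\<close>

text \<open>The quotients in (i) are the \<open>merle_n b i\<close>, the numbers in (ii) are the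
  \<open>b i\<close>, and (iii) is the telescoped gcd identity.\<close>

lemma arith_conditions_merle:
  assumes "merle_seq h b"
    and L: "\<And>k. k \<in> {1..h} \<Longrightarrow> L k = (merle_n b k - 1) * b k"
    and M: "\<And>k. k \<in> {1..h} \<Longrightarrow> M k = (merle_n b k - 1) * (\<Prod>j=1..<k. merle_n b j)"
  shows "arith_conditions h L M"
proof -
  have n: "1 < merle_n b k" if "k \<in> {1..h}" for k using assms(1) that by (simp add: merle_seq_def)
  have n0: "0 < merle_n b k" if "k \<in> {1..h}" for k using n[OF that] by simp
  have H: "H_seq M i = (\<Prod>j=1..i. merle_n b j)" if "i \<le> h" for i
    by (rule H_seq_telescope[OF n0 M that])
  have H0: "H_seq M i \<noteq> 0" for i by (simp add: H_seq_def)
  note C = C_nat_merle[OF assms]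
  have "(of_nat (H_seq M i) / of_nat (H_seq M (i - 1)) :: rat) \<in> \<int>" if i: "i \<in> {2..h}" for i
  proof -
    obtain j where j: "i = Suc j" using i by (cases i) auto
    have "H_seq M i = merle_n b i * H_seq M (i - 1)"
      using H[of i] H[of j] i j by (simp add: mult.commute)
    then show ?thesis using H0[of "i - 1"] by simp
  qed
  moreover have "C_seq h L M i \<in> \<int>" if "i \<in> {1..h}" for i using C(1)[of i] that by simp
  moreover have "of_nat (Gcd (C_nat h L M ` {0..i})) = C_seq h L M 0 / of_nat (H_seq M i)"
    if "i \<in> {1..h}" for i
  proof -
    have "C_nat h L M ` {0..i} = b ` {0..i}"
      using C(2) that by (intro image_cong) auto
    moreover have "H_seq M i * Gcd (b ` {0..i}) = b 0"
      using prod_merle_n_mult_Gcd[of b i] H[of i] that by simp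
    then have "(of_nat (H_seq M i) * of_nat (Gcd (b ` {0..i})) :: rat) = of_nat (b 0)"
      by (metis of_nat_mult)
    ultimately show ?thesis using C(1)[of 0] H0[of i] by (simp add: field_simps)
  qed
  ultimately show ?thesis unfolding arith_conditions_def by blast
qed

text \<open>Condition (iii) identifies \<open>merle_n\<close> of the sequence
  \<open>C_nat h L M\<close> at \<open>i\<close> with \<open>H_seq M i / H_seq M (i - 1)\<close>.
  Then \<open>M i\<close> and \<open>L i\<close> take the Merle shape, and increasing inclinations
  give (Z2).\<close>

lemma arith_conditions_imp_merle:
  assumes canon: "canonical_form D h (\<lambda>i. enat (L i)) (\<lambda>i. enat (M i))"
    and arith: "arith_conditions h L M"
  shows "merle_seq h (C_nat h L M)" "D = merle_diagram h (C_nat h L M)"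
proof -
  let ?C = "C_nat h L M" and ?H = "H_seq M"
  note h = canonical_form_finiteD(1)[OF canon]
  note pos = canonical_form_finiteD(2,3)[OF canon]
  have H0: "0 < ?H i" for i by (simp add: H_seq_def)
  have H_0: "?H 0 = 1" by (simp add: H_seq_def)
  have H_Suc: "?H i = ?H (i - 1) + M i" if "i \<in> {1..h}" for i
    using that by (cases i) (auto simp: H_seq_def)
  \<comment> \<open>An integral non-negative rational survives \<open>floor\<close> and
    \<open>nat\<close> unchanged.\<close>
  have C: "C_seq h L M i = of_nat (?C i)" if "i \<le> h" for i
  proof -
    have "C_seq h L M i \<in> \<int>"
      using arith that by (cases "i = 0") (auto simp: arith_conditions_def C_seq_def)
    then obtain z where z: "C_seq h L M i = of_int z" by (rule Ints_cases)
    moreover have "0 \<le> C_seq h L M i" by (simp add: C_seq_def)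
    ultimately show ?thesis by (simp add: C_nat_def)
  qed
  have C_0: "?C 0 = ?H h" by (simp add: C_nat_def C_seq_def)
  have CM: "?C i * M i = ?H (i - 1) * L i" if "i \<in> {1..h}" for i
  proof -
    have "(of_nat (?C i) :: rat) * of_nat (M i) = of_nat (?H (i - 1)) * of_nat (L i)"
      using C[of i] pos(2)[OF that] that by (auto simp: C_seq_def field_simps)
    then show ?thesis by (metis of_nat_eq_iff of_nat_mult)
  qed
  \<comment> \<open>Condition (iii) without division, extended to \<open>i = 0\<close>, where it
    reads \<open>?C 0 * 1 = ?H h\<close>.\<close>
  have Gcd: "Gcd (?C ` {0..i}) * ?H i = ?H h" if "i \<le> h" for i
  proof (cases "i = 0")
    case False
    then have "of_nat (Gcd (?C ` {0..i})) = C_seq h L M 0 / of_nat (?H i)"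
      using arith that by (simp add: arith_conditions_def)
    then have "(of_nat (Gcd (?C ` {0..i})) :: rat) * of_nat (?H i) = of_nat (?H h)"
      using H0[of i] by (simp add: C_seq_def field_simps)
    then show ?thesis by (metis of_nat_eq_iff of_nat_mult)
  qed (simp add: C_0 H_0)
  have n: "?H i = merle_n ?C i * ?H (i - 1)" if i: "i \<in> {1..h}" for i
  proof -
    obtain j where j: "i = Suc j" using i by (cases i) auto
    \<comment> \<open>Both sides equal \<open>?H h\<close>, by the gcd identity at \<open>i\<close>
      and at \<open>i - 1\<close>; the gcd is then cancelled.\<close>
    have "Gcd (?C ` {0..i}) * ?H i = Gcd (?C ` {0..i}) * (merle_n ?C i * ?H (i - 1))"
      using Gcd[of i] Gcd[of j] i j merle_n_mult_Gcd[of ?C j]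
      by (metis Suc_leD atLeastAtMost_iff diff_Suc_1 mult.assoc mult.commute)
    moreover have "Gcd (?C ` {0..i}) \<noteq> 0" using Gcd[of i] i H0[of h] by (metis atLeastAtMost_iff less_irrefl mult_0)
    ultimately show ?thesis by simp
  qed
  \<comment> \<open>Otherwise \<open>?H i\<close> would not exceed \<open>?H (i - 1)\<close>,
    contrary to \<open>M i > 0\<close>.\<close>
  have n_gt: "1 < merle_n ?C i" if "i \<in> {1..h}" for i
  proof (rule ccontr)
    assume "\<not> 1 < merle_n ?C i"
    then have "merle_n ?C i * ?H (i - 1) \<le> 1 * ?H (i - 1)" by (intro mult_right_mono) auto
    then show False using n[OF that] H_Suc[OF that] pos(2)[OF that] by linarith
  qed
  have prod: "(\<Prod>j=1..i. merle_n ?C j) = ?H i" if "i \<le> h" for i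
    using that
  proof (induction i)
    case (Suc i)
    then show ?case using n[of "Suc i"] by (simp add: mult.commute)
  qed (simp add: H_0)
  have prod': "(\<Prod>j=1..<i. merle_n ?C j) = ?H (i - 1)" if "i \<in> {1..h}" for i
  proof -
    have "{1..<i} = {1..i - 1}" "i - 1 \<le> h" using that by auto
    then show ?thesis using prod[of "i - 1"] by simp
  qed
  have M: "(merle_n ?C i - 1) * ?H (i - 1) = M i" if "i \<in> {1..h}" for i
    using n[OF that] H_Suc[OF that] by (simp add: diff_mult_distrib)
  have L: "(merle_n ?C i - 1) * ?C i = L i" if "i \<in> {1..h}" for i
  proof -
    have "?H (i - 1) * ((merle_n ?C i - 1) * ?C i) = ?C i * M i"
      using M[OF that] by (metis mult.assoc mult.commute)
    also have "\<dots> = ?H (i - 1) * L i" by (rule CM[OF that])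
    finally show ?thesis using H0[of "i - 1"] by simp
  qed
  \<comment> \<open>Each \<open>?C i\<close> is \<open>?H (i - 1)\<close> times the
    \<open>i\<close>-th inclination, and \<open>merle_n ?C k\<close> raises the factor
    \<open>?H (k - 1)\<close> to \<open>?H k\<close>. Both sides thus carry the factor
    \<open>?H k\<close>, and only the inclinations differ.\<close>
  have "merle_n ?C k * ?C k < ?C (k + 1)" if k: "k \<in> {1..<h}" for k
  proof -
    have k': "k \<in> {1..h}" "k + 1 \<in> {1..h}" using k by auto
    have C1: "real (?C i) = real (?H (i - 1)) * (real (L i) / real (M i))" if "i \<in> {1..h}" for i
      using arg_cong[OF CM[OF that], of real] pos(2)[OF that] by (simp add: field_simps)
    have "real (merle_n ?C k * ?C k) = real (?H k) * (real (L k) / real (M k))"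
      using C1[OF k'(1)] n[OF k'(1)] by simp
    also have "\<dots> < real (?H k) * (real (L (k + 1)) / real (M (k + 1)))"
      using canonical_form_finiteD(5)[OF canon k] H0[of k] by (intro mult_strict_left_mono) auto
    also have "\<dots> = real (?C (k + 1))" using C1[OF k'(2)] by simp
    finally show ?thesis unfolding of_nat_less_iff .
  qed
  moreover have "0 < ?C k" if "k \<in> {0..h}" for k
  proof (cases "k = 0")
    case True
    then show ?thesis using C_0 H0 by simp
  next
    case False
    then have "k \<in> {1..h}" using that by simp
    \<comment> \<open>If \<open>?C k\<close> were 0, then \<open>L k\<close>, which has it as a
      factor, would vanish.\<close>
    then show ?thesis using L[of k] pos(1)[of k] by (cases "?C k") auto
  qed
  ultimately show "merle_seq h ?C"
    using h n_gt prod[of h] C_0 by (simp add: merle_seq_def)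
  show "D = merle_diagram h ?C"
    unfolding canonical_form_finiteD(4)[OF canon] merle_diagram_def
    using prod' L M by (intro sum.cong refl) (simp del: One_nat_def)
qed

theorem theorem2p3:
  fixes D :: "(real \<times> real) set" and h :: nat and L M :: "nat \<Rightarrow> nat"
  assumes "newton_diagram D" and "convenient D"
    and "canonical_form D h (\<lambda>i. enat (L i)) (\<lambda>i. enat (M i))"
  shows "(merle_type D \<longleftrightarrow> arith_conditions h L M)
    \<and> (merle_type D \<longrightarrow>
         merle_seq h (C_nat h L M) \<and> D = merle_diagram h (C_nat h L M))"
proof -
  have "arith_conditions h L M" if merle: "merle_type D"
  proof -
    obtain s b where b: "merle_seq s b" "D = merle_diagram s b"
      using merle unfolding merle_type_def by blast
    \<comment> \<open>The Merle sum is itself a canonical form of \<open>D\<close>, so its length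
      and entries agree with the given ones.\<close>
    note unique = canonical_form_unique[OF assms(3)
        canonical_form_merle_diagram[OF b(1), folded b(2)]]
    show ?thesis
      using b(1) unique by (intro arith_conditions_merle[where b = b]) auto
  qed
  then show ?thesis
    using arith_conditions_imp_merle[OF assms(3)] unfolding merle_type_def by blast
qed

end
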